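(* Let $(x_t)_{t\ge 0}$ be any state trajectory of the closed loop $$x_{t+1}=-W_{t-1}\lambda_{t-1}(x_t)+w_t,\qquad u_t=(U_{t-1}-X^+_{t-1})\lambda_{t-1}(x_t),\qquad t\ge 0,$$ and let $\tau\ge 0$ be any integer. Put $\kappa_\tau:=\|\mathsf{W}\|_{\mathsf{X}_{\tau-1}}$. Then for every $\mu$ in the open interval $$\mathcal{I}_{\kappa_\tau}:=\Big(\Big(\sqrt{\tfrac14+\tfrac1{\kappa_\tau}}+\tfrac12\Big)^{-1},\,1\Big)$$ the set $$\mathcal{X}_\mu((x_t);\tau):=\{\,x_t \;:\; t\ge\tau,\ (x_{t+1},x_t)\in\mathcal{U}_\mu\,\}$$ is finite, and its cardinality satisfies $|\mathcal{X}_\mu((x_t);\tau)|\le N(\mu;\kappa_\tau)$, where $$N(\mu;\kappa_\tau):=\tfrac12\left(\frac{\mu}{\mu-\sqrt{\kappa_\tau(1-\mu)}}\right)^n\max\left\{1,\frac{\mu}{1-\mu}\right\}^n .$$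
   Context: System and controller. Let $A_0\in\mathbb{R}^{n\times n}$, let $(w_t)_{t\ge0}$ be a bounded sequence in $\mathbb{R}^n$, and consider $x_{t+1}=A_0x_t+u_t+w_t$, $t\ge 0$, with arbitrary $x_0\in\mathbb{R}^n$. Fix initialization matrices $X_{-1},U_{-1},X^+_{-1}\in\mathbb{R}^{n\times n_0}$ with $n_0>n$ and $\mathrm{rank}(X_{-1})=n$. For $t\ge0$ define the data matrices $X_t:=[x_t,x_{t-1},\dots,x_0,X_{-1}]$, $U_t:=[u_t,\dots,u_0,U_{-1}]$, $X^+_{t-1}:=[x_t,\dots,x_1,X^+_{-1}]$. Let $\lambda_{t-1}(x)$ be a minimizer of $\|\lambda\|_1$ subject to $X_{t-1}\lambda=x$ (possible non-uniqueness of the minimizer is ignored). The controller is $u_t=(U_{t-1}-X^+_{t-1})\lambda_{t-1}(x_t)$. Disturbances. Put $W_{-1}=[\hat w_1,\dots,\hat w_{n_0}]:=X^+_{-1}-A_0X_{-1}-U_{-1}$ (the $\hat w_i$ are called virtual disturbances) and $W_t:=[w_t,\dots,w_0,W_{-1}]$. With this controller the system becomes $x_{t+1}=-W_{t-1}\lambda_{t-1}(x_t)+w_t$. Define $\mathsf{W}:=\{w_t: t\in\mathbb{N}\}\cup\{\hat w_i:1\le i\le n_0\}$ (with $\mathbb N\ni 0$), and let $\mathsf{X}_t$ denote the set of columns of $X_t$. Norms. For a bounded set $\mathsf{S}\subset\mathbb{R}^n$, $\mathrm{c}(\mathsf{S})$ is the closure of the absolute convex hull $\{\sum_{i=1}^N\lambda_ix_i: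 N\in\mathbb N,\ x_i\in\mathsf{S},\ \sum_i|\lambda_i|\le1\}$. Define $\|x\|_{\mathsf{S}}:=\min\{r\ge0: x\in r\,\mathrm{c}(\mathsf{S})\}$ if $x\in\mathrm{span}(\mathsf{S})$ and $\|x\|_{\mathsf{S}}:=\infty$ otherwise; for a set $\mathsf{S}'$, $\|\mathsf{S}'\|_{\mathsf{S}}:=\max_{z\in\mathrm{c}(\mathsf{S}')}\|z\|_{\mathsf{S}}$. Unstable transitions. For $0<\mu<1$, $\mathcal{U}_\mu:=\{(x^+,x)\in\mathbb{R}^n\times\mathbb{R}^n:\ \|x^+\|_{\mathsf{W}}>\max\{\tfrac1{1-\mu},\ \mu\|x\|_{\mathsf{W}}+1\}\}$. *)

theory Defs
  imports "HOL-Analysis.Analysis"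
begin

section \<open>The norm generated by a set\<close>

definition abs_convex_hull :: "'a::real_vector set \<Rightarrow> 'a set" where
  "abs_convex_hull S =
     {\<Sum>i<N. l i *\<^sub>R v i | (N::nat) (l::nat \<Rightarrow> real) v. (\<forall>i<N. v i \<in> S) \<and> (\<Sum>i<N. \<bar>l i\<bar>) \<le> 1}"

definition cl_abs_hull :: "'a::real_normed_vector set \<Rightarrow> 'a set" where
  "cl_abs_hull S = closure (abs_convex_hull S)"

text \<open>For bounded \<open>S\<close> the infimum below is attained, see \<open>set_norm_attained\<close>.\<close>

definition set_norm :: "'a::real_normed_vector set \<Rightarrow> 'a \<Rightarrow> ereal" where
  "set_norm S x =
     (if x \<in> span S then ereal (Inf {r. 0 \<le> r \<and> x \<in> (*\<^sub>R) r ` cl_abs_hull S}) else \<infinity>)"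

text \<open>\<open>set_norm_set S S'\<close> is the norm of the set \<open>S'\<close> relative to \<open>S\<close>; for bounded \<open>S'\<close> contained
  in the span of a bounded \<open>S\<close> it is finite, see \<open>set_norm_set_finite\<close>.\<close>

definition set_norm_set :: "'a::real_normed_vector set \<Rightarrow> 'a set \<Rightarrow> ereal" where
  "set_norm_set S S' = (SUP z\<in>cl_abs_hull S'. set_norm S z)"

lemma zero_in_abs_convex_hull: "0 \<in> abs_convex_hull S"
  unfolding abs_convex_hull_def by (rule CollectI, rule exI[of _ 0]) auto

lemma abs_convex_hull_norm_le:
  assumes "\<And>v. v \<in> S \<Longrightarrow> norm v \<le> B" "y \<in> abs_convex_hull S" "0 \<le> B"
  shows "norm y \<le> B"
proof -
  obtain N l v where y: "y = (\<Sum>i<N. l i *\<^sub>R v i)" and v: "\<forall>i<(N::nat). v i \<in> S"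
    and l: "(\<Sum>i<N. \<bar>l i\<bar>) \<le> 1"
    using assms(2) unfolding abs_convex_hull_def by blast
  have "norm y \<le> (\<Sum>i<N. norm (l i *\<^sub>R v i))" unfolding y by (rule norm_sum)
  also have "\<dots> \<le> (\<Sum>i<N. \<bar>l i\<bar> * B)"
    using v assms(1) by (intro sum_mono) (auto intro!: mult_left_mono)
  also have "\<dots> \<le> B"
    using mult_right_mono[OF l assms(3)] by (simp add: sum_distrib_right)
  finally show ?thesis .
qed

lemma cl_abs_hull_norm_bound:
  assumes "bounded S"
  obtains B where "B > 0" "\<And>y. y \<in> cl_abs_hull S \<Longrightarrow> norm y \<le> B"
proof -
  obtain B where B: "B > 0" "\<And>v. v \<in> S \<Longrightarrow> norm v \<le> B"
    using assms by (auto simp: bounded_pos)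
  have "cl_abs_hull S \<subseteq> cball 0 B"
    unfolding cl_abs_hull_def
    by (rule closure_minimal) (use abs_convex_hull_norm_le[OF B(2)] B(1) in auto)
  then show ?thesis by (intro that[OF B(1)]) auto
qed

lemma sum_in_scaled_hull:
  assumes t: "finite t" "t \<subseteq> S" and x: "x = (\<Sum>v\<in>t. u v *\<^sub>R v)"
    and r: "r > 0" "(\<Sum>v\<in>t. \<bar>u v\<bar>) \<le> r"
  shows "x \<in> (*\<^sub>R) r ` cl_abs_hull S"
proof -
  obtain f where f: "bij_betw f {..<card t} t"
    using ex_bij_betw_nat_finite[OF t(1)] by (auto simp: atLeast0LessThan)
  have "(\<Sum>i<card t. \<bar>u (f i) / r\<bar>) = (\<Sum>v\<in>t. \<bar>u v / r\<bar>)"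
    by (rule sum.reindex_bij_betw[OF f])
  also have "\<dots> = (\<Sum>v\<in>t. \<bar>u v\<bar>) / r" using r by (simp add: sum_divide_distrib)
  also have "\<dots> \<le> 1" using r by simp
  finally have l: "(\<Sum>i<card t. \<bar>u (f i) / r\<bar>) \<le> 1" .
  have "(\<Sum>i<card t. (u (f i) / r) *\<^sub>R f i) = (\<Sum>v\<in>t. (u v / r) *\<^sub>R v)"
    by (rule sum.reindex_bij_betw[OF f])
  also have "r *\<^sub>R \<dots> = x" using r by (simp add: x scaleR_sum_right)
  finally have eq: "x = r *\<^sub>R (\<Sum>i<card t. (u (f i) / r) *\<^sub>R f i)" by simp
  have "\<forall>i<card t. f i \<in> S" using f t(2) by (auto simp: bij_betw_def)
  with l have "(\<Sum>i<card t. (u (f i) / r) *\<^sub>R f i) \<in> abs_convex_hull S"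
    unfolding abs_convex_hull_def
    by (intro CollectI exI[of _ "card t"] exI[of _ "\<lambda>i. u (f i) / r"] exI[of _ f]) auto
  then have "(\<Sum>i<card t. (u (f i) / r) *\<^sub>R f i) \<in> cl_abs_hull S"
    unfolding cl_abs_hull_def using closure_subset by blast
  then show ?thesis using eq by blast
qed

lemma span_in_scaled_hull:
  assumes "x \<in> span S"
  shows "\<exists>r\<ge>0. x \<in> (*\<^sub>R) r ` cl_abs_hull S"
proof -
  obtain t u where t: "finite t" "t \<subseteq> S" and x: "x = (\<Sum>v\<in>t. u v *\<^sub>R v)"
    using assms unfolding span_explicit by blast
  have pos: "0 < 1 + (\<Sum>v\<in>t. \<bar>u v\<bar>)" by (intro add_pos_nonneg sum_nonneg) auto
  have "x \<in> (*\<^sub>R) (1 + (\<Sum>v\<in>t. \<bar>u v\<bar>)) ` cl_abs_hull S"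
    by (rule sum_in_scaled_hull[OF t x pos]) simp
  then show ?thesis using pos by (meson less_imp_le)
qed

lemma set_norm_attained:
  assumes "bounded S" "x \<in> span S"
  obtains r where "set_norm S x = ereal r" "0 \<le> r" "x \<in> (*\<^sub>R) r ` cl_abs_hull S"
    "\<And>s. 0 \<le> s \<Longrightarrow> x \<in> (*\<^sub>R) s ` cl_abs_hull S \<Longrightarrow> r \<le> s"
proof -
  define R where "R = {r. 0 \<le> r \<and> x \<in> (*\<^sub>R) r ` cl_abs_hull S}"
  obtain B where B: "B > 0" "\<And>y. y \<in> cl_abs_hull S \<Longrightarrow> norm y \<le> B"
    using cl_abs_hull_norm_bound[OF assms(1)] by blast
  have ne: "R \<noteq> {}" using span_in_scaled_hull[OF assms(2)] by (auto simp: R_def)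
  have bdd: "bdd_below R" by (rule bdd_belowI[of _ 0]) (simp add: R_def)
  have nonneg: "0 \<le> Inf R" by (rule cInf_greatest[OF ne]) (simp add: R_def)
  have "Inf R \<in> closure R" by (rule closure_contains_Inf[OF ne bdd])
  then obtain q where q: "\<And>k. q k \<in> R" "q \<longlonglongrightarrow> Inf R"
    by (auto simp: closure_sequential)
  have mem: "x \<in> (*\<^sub>R) (Inf R) ` cl_abs_hull S"
  proof (cases "Inf R = 0")
    case True
    have "norm x \<le> q k * B" for k
      using q(1)[of k] B(2) by (auto simp: R_def intro!: mult_left_mono)
    moreover have "(\<lambda>k. q k * B) \<longlonglongrightarrow> Inf R * B" by (intro tendsto_intros q(2))
    ultimately have "norm x \<le> Inf R * B" by (intro LIMSEQ_le_const) auto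
    then have "x = 0" using True by simp
    moreover have "0 \<in> cl_abs_hull S"
      unfolding cl_abs_hull_def using closure_subset zero_in_abs_convex_hull by blast
    ultimately show ?thesis by (intro image_eqI[of _ _ 0]) auto
  next
    case False
    with nonneg have pos: "0 < Inf R" by simp
    have le: "Inf R \<le> q k" for k by (rule cInf_lower[OF q(1) bdd])
    have mem: "inverse (q k) *\<^sub>R x \<in> cl_abs_hull S" for k
    proof -
      obtain y where y: "y \<in> cl_abs_hull S" "x = q k *\<^sub>R y" using q(1)[of k] by (auto simp: R_def)
      have "q k \<noteq> 0" using le[of k] pos by linarith
      then show ?thesis using y by simp
    qed
    have lim: "(\<lambda>k. inverse (q k) *\<^sub>R x) \<longlonglongrightarrow> inverse (Inf R) *\<^sub>R x"
      using False by (intro tendsto_intros q(2))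
    have cl: "closed (cl_abs_hull S)" by (simp add: cl_abs_hull_def)
    have "inverse (Inf R) *\<^sub>R x \<in> cl_abs_hull S"
      by (rule closed_sequentially[OF cl mem lim])
    then show ?thesis using False by (intro image_eqI[of _ _ "inverse (Inf R) *\<^sub>R x"]) auto
  qed
  show ?thesis
  proof (rule that)
    show "set_norm S x = ereal (Inf R)" using assms(2) by (simp add: set_norm_def R_def)
  qed (use nonneg mem in \<open>auto intro!: cInf_lower bdd simp: R_def\<close>)
qed

lemma set_norm_le_imp:
  assumes "0 \<le> s" "x \<in> span S" "x \<in> (*\<^sub>R) s ` cl_abs_hull S"
  shows "set_norm S x \<le> ereal s"
proof -
  have "bdd_below {r. 0 \<le> r \<and> x \<in> (*\<^sub>R) r ` cl_abs_hull S}"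
    by (rule bdd_belowI[of _ 0]) simp
  then show ?thesis using assms by (auto simp: set_norm_def intro!: cInf_lower)
qed

lemma set_norm_set_finite:
  fixes S S' :: "'a::euclidean_space set"
  assumes S: "bounded S" "bounded S'" "S' \<subseteq> span S"
  shows "\<bar>set_norm_set S S'\<bar> \<noteq> \<infinity>"
proof -
  obtain B where B: "B \<subseteq> S" "independent B" "span B = span S"
    using maximal_independent_subset[of S] span_mono span_span
    by (metis span_minimal subspace_span subset_antisym)
  have finB: "finite B" using B(2) by (rule independent_imp_finite)
  have "\<exists>g::'a \<Rightarrow> real. linear g \<and> (\<forall>v\<in>B. g v = (if v = b then 1 else 0))" for b
    using linear_independent_extend[OF B(2), of "\<lambda>v. if v = b then 1 else 0"] by blast
  then obtain g :: "'a \<Rightarrow> 'a \<Rightarrow> real"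
    where g: "\<And>b. linear (g b)" "\<And>b v. v \<in> B \<Longrightarrow> g b v = (if v = b then 1 else 0)"
    by metis
  have expand: "z = (\<Sum>b\<in>B. g b z *\<^sub>R b)" if "z \<in> span S" for z
  proof (rule linear_eq_on_span[where B = B and f = "\<lambda>z. z"])
    show "linear (\<lambda>z. \<Sum>b\<in>B. g b z *\<^sub>R b)"
      using g(1) by (intro linear_compose_sum) (auto simp: linear_iff scaleR_left_distrib)
    show "x = (\<Sum>b\<in>B. g b x *\<^sub>R b)" if "x \<in> B" for x
      using that finB by (simp add: g(2) if_distrib[of "\<lambda>c. c *\<^sub>R _"] cong: if_cong)
  qed (use that B(3) in \<open>auto simp: linear_iff\<close>)
  obtain D where D: "D > 0" "\<And>y. y \<in> cl_abs_hull S' \<Longrightarrow> norm y \<le> D"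
    using cl_abs_hull_norm_bound[OF S(2)] by blast
  have "abs_convex_hull S' \<subseteq> span S"
    using S(3) by (fastforce simp: abs_convex_hull_def intro!: span_sum span_mul)
  then have sub: "cl_abs_hull S' \<subseteq> span S"
    unfolding cl_abs_hull_def by (rule closure_minimal) (rule closed_span)
  define K where "K = 1 + (\<Sum>b\<in>B. onorm (g b) * D)"
  have on: "onorm (g b) \<ge> 0" for b
    using g(1) by (intro onorm_pos_le) (simp add: linear_conv_bounded_linear)
  have K: "K > 0" unfolding K_def using on D(1) by (intro add_pos_nonneg sum_nonneg) auto
  have le: "set_norm S z \<le> ereal K" if z: "z \<in> cl_abs_hull S'" for z
  proof -
    have "\<bar>g b z\<bar> \<le> onorm (g b) * D" for b
    proof -
      have "\<bar>g b z\<bar> \<le> onorm (g b) * norm z"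
        using onorm[of "g b" z] g(1) by (simp add: linear_conv_bounded_linear)
      also have "\<dots> \<le> onorm (g b) * D" using D(2)[OF z] on by (rule mult_left_mono)
      finally show ?thesis .
    qed
    then have "(\<Sum>b\<in>B. \<bar>g b z\<bar>) \<le> (\<Sum>b\<in>B. onorm (g b) * D)"
      by (rule sum_mono)
    then have sum_le: "(\<Sum>b\<in>B. \<bar>g b z\<bar>) \<le> K" by (simp add: K_def)
    have "z \<in> span S" using sub z by (rule subsetD)
    from sum_in_scaled_hull[OF finB B(1) expand[OF this] K sum_le]
    have "z \<in> (*\<^sub>R) K ` cl_abs_hull S" .
    then show ?thesis using sub z K by (intro set_norm_le_imp) auto
  qed
  have "set_norm_set S S' \<le> ereal K" unfolding set_norm_set_def using le by (rule SUP_least)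
  moreover have "0 \<le> set_norm_set S S'"
  proof -
    have z: "0 \<in> cl_abs_hull S'"
      unfolding cl_abs_hull_def using closure_subset zero_in_abs_convex_hull by blast
    obtain r where "set_norm S 0 = ereal r" "0 \<le> r"
      using set_norm_attained[OF S(1) span_zero] by blast
    then show ?thesis unfolding set_norm_set_def using z by (intro SUP_upper2[of 0]) auto
  qed
  ultimately show ?thesis by auto
qed

section \<open>Data matrices\<close>

text \<open>
  A data matrix with columns \<open>v (t - 1), \<dots>, v 0\<close> followed by those of an initial matrix \<open>V\<close> is
  stored as a family of columns: column \<open>Inl s\<close>, for \<open>s < t\<close>, belongs to time \<open>s\<close>, and column
  \<open>Inr j\<close> is the \<open>j\<close>-th column of \<open>V\<close>. The number of columns grows with \<open>t\<close>, so \<open>t\<close> is an argument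
  of the index set and not a part of the type. \<open>data_idx t\<close> indexes the columns of the data
  matrices which carry the subscript \<open>t - 1\<close>; in particular \<open>data_idx 0\<close> is for subscript \<open>- 1\<close>.
\<close>

definition data_idx :: "nat \<Rightarrow> (nat + 'm) set" where
  "data_idx t = {..<t} <+> UNIV"

definition data_col :: "(nat \<Rightarrow> real^'n) \<Rightarrow> real^'m^'n \<Rightarrow> nat + 'm::finite \<Rightarrow> real^'n" where
  "data_col v V = case_sum v (\<lambda>j. column j V)"

definition data_mult :: "(nat + 'm::finite \<Rightarrow> real^'n) \<Rightarrow> nat \<Rightarrow> (nat + 'm \<Rightarrow> real) \<Rightarrow> real^'n" where
  "data_mult C t l = (\<Sum>i\<in>data_idx t. l i *\<^sub>R C i)"

text \<open>\<open>l1_minimizer C t z l\<close>: the coefficient vector \<open>l\<close> minimizes the 1-norm among all solutions of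
  the linear system with the data matrix of subscript \<open>t - 1\<close> and right-hand side \<open>z\<close>. The values
  of \<open>l\<close> outside \<open>data_idx t\<close> play no role.\<close>

definition l1_minimizer ::
    "(nat + 'm::finite \<Rightarrow> real^'n) \<Rightarrow> nat \<Rightarrow> real^'n \<Rightarrow> (nat + 'm \<Rightarrow> real) \<Rightarrow> bool" where
  "l1_minimizer C t z l \<longleftrightarrow>
     is_arg_min (\<lambda>l. \<Sum>i\<in>data_idx t. \<bar>l i\<bar>) (\<lambda>l. data_mult C t l = z) l"

section \<open>The closed loop\<close>

definition virtual_dist ::
    "real^'n^'n \<Rightarrow> real^'m::finite^'n \<Rightarrow> real^'m^'n \<Rightarrow> real^'m^'n \<Rightarrow> real^'m^'n" where
  "virtual_dist A X0 U0 Xp0 = Xp0 - A ** X0 - U0"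

definition dist_set ::
    "real^'n^'n \<Rightarrow> real^'m::finite^'n \<Rightarrow> real^'m^'n \<Rightarrow> real^'m^'n \<Rightarrow> (nat \<Rightarrow> real^'n) \<Rightarrow> (real^'n) set"
  where
  "dist_set A X0 U0 Xp0 w = range w \<union> columns (virtual_dist A X0 U0 Xp0)"

text \<open>\<open>state_set X0 x t\<close> is the set of columns of the state data matrix with subscript \<open>t - 1\<close>.\<close>

definition state_set :: "real^'m::finite^'n \<Rightarrow> (nat \<Rightarrow> real^'n) \<Rightarrow> nat \<Rightarrow> (real^'n) set" where
  "state_set X0 x t = data_col x X0 ` data_idx t"

text \<open>
  The argument \<open>lam t\<close> is the selection of minimizers \<open>\<lambda>\<^bsub>t - 1\<^esub>\<close>. In the matrix \<open>X\<^sup>+\<close> with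
  subscript \<open>t - 1\<close> the column belonging to time \<open>s < t\<close> is \<open>x (Suc s)\<close>.
\<close>

definition closed_loop ::
    "real^'n^'n \<Rightarrow> real^'m::finite^'n \<Rightarrow> real^'m^'n \<Rightarrow> real^'m^'n \<Rightarrow> (nat \<Rightarrow> real^'n) \<Rightarrow>
     (nat \<Rightarrow> real^'n \<Rightarrow> nat + 'm \<Rightarrow> real) \<Rightarrow> (nat \<Rightarrow> real^'n) \<Rightarrow> (nat \<Rightarrow> real^'n) \<Rightarrow> bool" where
  "closed_loop A X0 U0 Xp0 w lam x u \<longleftrightarrow>
     (\<forall>t. x (Suc t) = A *v x t + u t + w t) \<and>
     (\<forall>t z. l1_minimizer (data_col x X0) t z (lam t z)) \<and>
     (\<forall>t. u t = data_mult (\<lambda>i. data_col u U0 i - data_col (\<lambda>s. x (Suc s)) Xp0 i) t (lam t (x t)))"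

definition unstable :: "(real^'n) set \<Rightarrow> real \<Rightarrow> ((real^'n) \<times> (real^'n)) set" where
  "unstable W \<mu> =
     {(xp, x). set_norm W xp > max (ereal (1 / (1 - \<mu>))) (ereal \<mu> * set_norm W x + 1)}"

definition unstable_states ::
    "(real^'n) set \<Rightarrow> real \<Rightarrow> (nat \<Rightarrow> real^'n) \<Rightarrow> nat \<Rightarrow> (real^'n) set" where
  "unstable_states W \<mu> x \<tau> = {x t | t. \<tau> \<le> t \<and> (x (Suc t), x t) \<in> unstable W \<mu>}"

text \<open>For \<open>\<kappa> = 0\<close> (no disturbances at all) the expression \<open>1 / \<kappa>\<close> is read as infinity, so
  that the left end point of the interval is 0.\<close>

definition mu_interval :: "real \<Rightarrow> real set" where
  "mu_interval \<kappa> = {(if \<kappa> = 0 then 0 else inverse (sqrt (1/4 + 1/\<kappa>) + 1/2)) <..< 1}"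

definition unstable_bound :: "nat \<Rightarrow> real \<Rightarrow> real \<Rightarrow> real" where
  "unstable_bound n \<mu> \<kappa> =
     1/2 * (\<mu> / (\<mu> - sqrt (\<kappa> * (1 - \<mu>)))) ^ n * (max 1 (\<mu> / (1 - \<mu>))) ^ n"

text \<open>Eliminating the input gives the closed loop in terms of the disturbances only.\<close>

lemma matrix_column_mult: "column j ((A::real^'n^'n) ** (B::real^'m::finite^'n)) = A *v column j B"
  by (simp add: vec_eq_iff column_def matrix_matrix_mult_def matrix_vector_mult_def)

lemma data_mult_cong:
  assumes "\<And>s. s < t \<Longrightarrow> C (Inl s) = D (Inl s)" "\<And>j. C (Inr j) = D (Inr j)"
  shows "data_mult C t l = data_mult D t l"
  unfolding data_mult_def data_idx_def by (rule sum.cong) (auto simp: assms)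

lemma plant_data_step:
  fixes A :: "real^'n^'n" and X0 :: "real^'m::finite^'n"
  assumes past: "\<And>s. s < t \<Longrightarrow> x (Suc s) = A *v x s + u s + w s"
    and l: "data_mult (data_col x X0) t l = x t"
    and u: "u t = data_mult (\<lambda>i. data_col u U0 i - data_col (\<lambda>s. x (Suc s)) Xp0 i) t l"
  shows "A *v x t + u t + w t =
     - data_mult (data_col w (virtual_dist A X0 U0 Xp0)) t l + w t"
proof -
  have "data_mult (data_col w (virtual_dist A X0 U0 Xp0)) t l =
      data_mult (\<lambda>i. data_col (\<lambda>s. x (Suc s)) Xp0 i - A *v data_col x X0 i - data_col u U0 i) t l"
  proof (rule data_mult_cong)
    fix s assume "s < t"
    then show "data_col w (virtual_dist A X0 U0 Xp0) (Inl s) = data_col (\<lambda>s. x (Suc s)) Xp0 (Inl s)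
        - A *v data_col x X0 (Inl s) - data_col u U0 (Inl s)"
      using past[of s] by (simp add: data_col_def)
  next
    fix j
    have "column j (virtual_dist A X0 U0 Xp0) = column j Xp0 - column j (A ** X0) - column j U0"
      by (simp add: virtual_dist_def column_def vec_eq_iff)
    then show "data_col w (virtual_dist A X0 U0 Xp0) (Inr j) = data_col (\<lambda>s. x (Suc s)) Xp0 (Inr j)
        - A *v data_col x X0 (Inr j) - data_col u U0 (Inr j)"
      by (simp add: data_col_def matrix_column_mult)
  qed
  also have "\<dots> = - u t - A *v data_mult (data_col x X0) t l"
    unfolding u data_mult_def
    by (simp add: linear_sum[OF matrix_vector_mul_linear] matrix_vector_mult_scaleR
        scaleR_diff_right sum_subtractf)
  finally show ?thesis by (simp add: l)
qed

lemma closed_loop_iff: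
  "closed_loop A X0 U0 Xp0 w lam x u \<longleftrightarrow>
     (\<forall>t. x (Suc t) =
        - data_mult (data_col w (virtual_dist A X0 U0 Xp0)) t (lam t (x t)) + w t) \<and>
     (\<forall>t z. l1_minimizer (data_col x X0) t z (lam t z)) \<and>
     (\<forall>t. u t = data_mult (\<lambda>i. data_col u U0 i - data_col (\<lambda>s. x (Suc s)) Xp0 i) t (lam t (x t)))"
  (is "_ \<longleftrightarrow> ?L \<and> ?M \<and> ?U")
proof -
  let ?P = "\<forall>t. x (Suc t) = A *v x t + u t + w t"
  have "?P \<longleftrightarrow> ?L" if M: ?M and U: ?U
  proof -
    have l: "data_mult (data_col x X0) t (lam t (x t)) = x t" for t
      using M by (auto simp: l1_minimizer_def is_arg_min_def)
    note step = plant_data_step[OF _ l U[rule_format]]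
    show ?thesis
    proof
      assume ?P
      then show ?L using step by simp
    next
      assume L: ?L
      have "x (Suc t) = A *v x t + u t + w t" for t
      proof (induction t rule: less_induct)
        case (less t)
        then show ?case using step[where t = t and w = w] L by simp
      qed
      then show ?P by blast
    qed
  qed
  then show ?thesis unfolding closed_loop_def by blast
qed

end

theory Submission
  imports Defs
begin

text \<open>
  Write \<open>K = c(W)\<close>, \<open>H\<^sub>t = c(X\<^sub>t\<^sub>-\<^sub>1)\<close> and \<open>\<nu>\<^sub>t = \<parallel>x\<^sub>t\<parallel>\<^sub>W\<close>. The next state has \<open>W\<close>-norm at most one more
  than the minimal 1-norm, so an unstable transition at time \<open>t\<close> forces \<open>x\<^sub>t\<close> out of \<open>r H\<^sub>t\<close> for
  \<open>r = max (\<mu> / (1 - \<mu>)) (\<mu> \<nu>\<^sub>t)\<close>. For \<open>t \<ge> \<tau>\<close> we have \<open>K \<subseteq> \<kappa> H\<^sub>t\<close>, hence \<open>r < \<kappa> \<nu>\<^sub>t\<close>. As \<open>H\<^sub>t\<close> also contains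
  every earlier state, the normalized unstable states \<open>x\<^sub>t / \<nu>\<^sub>t\<close> and their negatives have pairwise
  \<open>W\<close>-distance larger than \<open>\<delta> = \<mu> / \<kappa> - (1 - \<mu>) / \<mu>\<close>. A volume comparison allows at most
  \<open>(1 + 2 / \<delta>)\<^sup>n\<close> such points in \<open>K\<close>, and \<open>1 + 2 / \<delta>\<close> is at most the base of the claimed bound.
\<close>

section \<open>Absolutely convex sets\<close>

definition abs_convex :: "'a::real_vector set \<Rightarrow> bool" where
  "abs_convex K \<longleftrightarrow> convex K \<and> 0 \<in> K \<and> (\<forall>x\<in>K. - x \<in> K)"

text \<open>Shrinking towards 0 stays in \<open>K\<close>, so the dilates of \<open>K\<close> are
  nested. Escaping one dilate therefore means escaping every smaller one.\<close>

lemma abs_convex_scaled_mono: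
  assumes K: "abs_convex K" and rs: "0 \<le> s" "s \<le> r" and x: "x \<in> (*\<^sub>R) s ` K"
  shows "x \<in> (*\<^sub>R) r ` K"
proof (cases "r = 0")
  case True
  then show ?thesis using x rs by auto
next
  case False
  then have r: "r > 0" using rs by simp
  obtain y where y: "y \<in> K" "x = s *\<^sub>R y" using x by blast
  have "(s / r) *\<^sub>R y + (1 - s / r) *\<^sub>R 0 \<in> K"
    using K y rs r by (intro convexD) (auto simp: abs_convex_def)
  then have "(s / r) *\<^sub>R y \<in> K" by simp
  then show ?thesis using y r by (intro image_eqI[of _ _ "(s / r) *\<^sub>R y"]) auto
qed

text \<open>By symmetry the signs of the coefficients go into the points; the absolute values,
  divided by their sum, are convex weights.\<close>

lemma abs_convex_sum:
  assumes K: "abs_convex K" and I: "finite I" and v: "\<And>i. i \<in> I \<Longrightarrow> v i \<in> K"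
    and r: "(\<Sum>i\<in>I. \<bar>c i\<bar>) \<le> r"
  shows "(\<Sum>i\<in>I. c i *\<^sub>R v i) \<in> (*\<^sub>R) r ` K"
proof -
  define s where "s = (\<Sum>i\<in>I. \<bar>c i\<bar>)"
  have s0: "s \<ge> 0" unfolding s_def by (rule sum_nonneg) simp
  have "(\<Sum>i\<in>I. c i *\<^sub>R v i) \<in> (*\<^sub>R) s ` K"
  proof (cases "s = 0")
    case True
    then have "c i = 0" if "i \<in> I" for i
      using that I by (simp add: s_def sum_nonneg_eq_0_iff)
    then have "(\<Sum>i\<in>I. c i *\<^sub>R v i) = 0" by (simp add: sum.neutral)
    then show ?thesis using K by (auto simp: abs_convex_def image_iff intro!: bexI[of _ 0])
  next
    case False
    have "(\<Sum>i\<in>I. (\<bar>c i\<bar> / s) *\<^sub>R (sgn (c i) *\<^sub>R v i)) \<in> K"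
    proof (rule convex_sum[OF I])
      show "convex K" using K by (simp add: abs_convex_def)
      show "(\<Sum>i\<in>I. \<bar>c i\<bar> / s) = 1"
        using False by (simp add: sum_divide_distrib[symmetric] s_def)
      show "sgn (c i) *\<^sub>R v i \<in> K" if "i \<in> I" for i
        using v[OF that] K by (auto simp: abs_convex_def sgn_if)
    qed (use s0 in simp)
    moreover have "(\<Sum>i\<in>I. c i *\<^sub>R v i) = s *\<^sub>R (\<Sum>i\<in>I. (\<bar>c i\<bar> / s) *\<^sub>R (sgn (c i) *\<^sub>R v i))"
      using False by (simp add: scaleR_sum_right mult.commute[of "\<bar>_\<bar>"] sgn_mult_abs)
    ultimately show ?thesis by blast
  qed
  then show ?thesis using abs_convex_scaled_mono[OF K s0] r by (simp add: s_def)
qed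

lemma abs_convex_combination:
  assumes "abs_convex K" "x \<in> K" "y \<in> K" "\<bar>a\<bar> + \<bar>b\<bar> \<le> r"
  shows "a *\<^sub>R x + b *\<^sub>R y \<in> (*\<^sub>R) r ` K"
  \<comment> \<open>Indexing by truth values keeps two summands even when
    \<open>x = y\<close>.\<close>
  using abs_convex_sum[of K "{True, False}" "\<lambda>i. if i then x else y" "\<lambda>i. if i then a else b" r] assms
  by simp

section \<open>The absolute convex hull and its closure\<close>

lemma abs_convex_abs_convex_hull: "abs_convex (abs_convex_hull S)"
  unfolding abs_convex_def
proof (intro conjI ballI zero_in_abs_convex_hull)
  fix x assume "x \<in> abs_convex_hull S"
  then obtain N l v where "x = (\<Sum>i<N. l i *\<^sub>R v i)" "\<forall>i<(N::nat). v i \<in> S" "(\<Sum>i<N. \<bar>l i\<bar>) \<le> 1"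
    unfolding abs_convex_hull_def by blast
  then show "- x \<in> abs_convex_hull S"
    unfolding abs_convex_hull_def
    by (intro CollectI exI[of _ N] exI[of _ "\<lambda>i. - l i"] exI[of _ v]) (auto simp: sum_negf)
next
  show "convex (abs_convex_hull S)"
  proof (rule convexI)
    fix x y and a b :: real
    assume "x \<in> abs_convex_hull S" "y \<in> abs_convex_hull S" and ab: "0 \<le> a" "0 \<le> b" "a + b = 1"
    then obtain N l v M k u where x: "x = (\<Sum>i<N. l i *\<^sub>R v i)" "\<forall>i<(N::nat). v i \<in> S"
        "(\<Sum>i<N. \<bar>l i\<bar>) \<le> 1" and y: "y = (\<Sum>i<M. k i *\<^sub>R u i)" "\<forall>i<(M::nat). u i \<in> S"
        "(\<Sum>i<M. \<bar>k i\<bar>) \<le> 1"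
      unfolding abs_convex_hull_def by blast
    define c where "c i = (if i < N then a * l i else b * k (i - N))" for i
    define z where "z i = (if i < N then v i else u (i - N))" for i
    have split: "(\<Sum>i<N + M. f i) = (\<Sum>i<N. f i) + (\<Sum>i<M. f (N + i))"
      for f :: "nat \<Rightarrow> 'c::comm_monoid_add"
      by (induction M) (simp_all add: add.assoc)
    have "(\<Sum>i<N + M. \<bar>c i\<bar>) = a * (\<Sum>i<N. \<bar>l i\<bar>) + b * (\<Sum>i<M. \<bar>k i\<bar>)"
      using ab by (simp add: split c_def abs_mult sum_distrib_left)
    also have "\<dots> \<le> a * 1 + b * 1" using x y ab by (intro add_mono mult_left_mono) auto
    finally have "(\<Sum>i<N + M. \<bar>c i\<bar>) \<le> 1" using ab by simp
    moreover have "a *\<^sub>R x + b *\<^sub>R y = (\<Sum>i<N + M. c i *\<^sub>R z i)"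
      by (simp add: split c_def z_def x y scaleR_sum_right)
    moreover have "\<forall>i<N + M. z i \<in> S" using x y by (auto simp: z_def)
    ultimately show "a *\<^sub>R x + b *\<^sub>R y \<in> abs_convex_hull S"
      unfolding abs_convex_hull_def by blast
  qed
qed

lemma subset_abs_convex_hull: "S \<subseteq> abs_convex_hull S"
proof
  fix x assume "x \<in> S"
  then show "x \<in> abs_convex_hull S"
    unfolding abs_convex_hull_def
    by (intro CollectI exI[of _ 1] exI[of _ "\<lambda>_. 1"] exI[of _ "\<lambda>_. x"]) auto
qed

lemma abs_convex_hull_eq_convex_hull:
  "abs_convex_hull S = convex hull (insert 0 (S \<union> uminus ` S))" (is "_ = ?H")
proof
  have neg: "uminus ` ?H = convex hull (uminus ` insert 0 (S \<union> uminus ` S))"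
    using convex_hull_scaling[of "-1" "insert 0 (S \<union> uminus ` S)"] by simp
  have "uminus ` insert 0 (S \<union> uminus ` S) = insert 0 (S \<union> uminus ` S)"
    by (auto simp: image_image image_Un)
  with neg have "uminus ` ?H = ?H" by simp
  then have "\<forall>x\<in>?H. - x \<in> ?H" by blast
  then have H: "abs_convex ?H" by (simp add: abs_convex_def hull_inc)
  show "abs_convex_hull S \<subseteq> ?H"
  proof
    fix x assume "x \<in> abs_convex_hull S"
    then obtain N l v where x: "x = (\<Sum>i<N. l i *\<^sub>R v i)" "\<forall>i<(N::nat). v i \<in> S"
        "(\<Sum>i<N. \<bar>l i\<bar>) \<le> 1"
      unfolding abs_convex_hull_def by blast
    have "(\<Sum>i<N. l i *\<^sub>R v i) \<in> (*\<^sub>R) 1 ` ?H"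
      using x by (intro abs_convex_sum[OF H]) (auto intro: hull_inc)
    then show "x \<in> ?H" by (simp add: x)
  qed
  show "?H \<subseteq> abs_convex_hull S"
    using abs_convex_abs_convex_hull[of S] subset_abs_convex_hull[of S]
    by (intro hull_minimal) (auto simp: abs_convex_def)
qed

text \<open>The hull of a finite set is a polytope and so already closed. A point in the hull of
  finitely many data columns thus comes with actual coefficients, which can be compared with a
  minimizer.\<close>

lemma cl_abs_hull_finite:
  fixes S :: "'a::euclidean_space set"
  assumes "finite S"
  shows "cl_abs_hull S = abs_convex_hull S"
  unfolding cl_abs_hull_def abs_convex_hull_eq_convex_hull
  using assms by (intro closure_closed compact_imp_closed finite_imp_compact_convex_hull) simp

lemma abs_convex_cl_abs_hull: "abs_convex (cl_abs_hull S)"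
proof -
  let ?A = "abs_convex_hull S"
  have A: "convex ?A" "\<forall>x\<in>?A. - x \<in> ?A"
    using abs_convex_abs_convex_hull[of S] by (auto simp: abs_convex_def)
  then have "uminus ` ?A = ?A" by force
  then have "uminus ` closure ?A = closure ?A"
    using closure_scaleR[of "-1" ?A] by simp
  then have "\<forall>x\<in>closure ?A. - x \<in> closure ?A" by blast
  then show ?thesis
    unfolding abs_convex_def cl_abs_hull_def
    using A closure_subset[of ?A] zero_in_abs_convex_hull[of S] by auto
qed

lemma subset_cl_abs_hull: "S \<subseteq> cl_abs_hull S"
  unfolding cl_abs_hull_def using subset_abs_convex_hull closure_subset by blast

lemma cl_abs_hull_mono: "S \<subseteq> T \<Longrightarrow> cl_abs_hull S \<subseteq> cl_abs_hull T"
  unfolding cl_abs_hull_def abs_convex_hull_def by (intro closure_mono) blast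

lemma compact_cl_abs_hull:
  fixes S :: "'a::euclidean_space set"
  assumes "bounded S"
  shows "compact (cl_abs_hull S)"
proof -
  obtain B where "\<And>y. y \<in> cl_abs_hull S \<Longrightarrow> norm y \<le> B"
    using cl_abs_hull_norm_bound[OF assms] by blast
  then have "bounded (cl_abs_hull S)" by (auto simp: bounded_iff)
  moreover have "closed (cl_abs_hull S)" by (simp add: cl_abs_hull_def)
  ultimately show ?thesis by (simp add: compact_eq_bounded_closed)
qed

lemma cl_abs_hull_subset_span:
  fixes S :: "'a::euclidean_space set"
  shows "cl_abs_hull S \<subseteq> span S"
proof -
  have "abs_convex_hull S \<subseteq> span S"
    by (auto simp: abs_convex_hull_def intro!: span_sum span_mul intro: span_base)
  then show ?thesis unfolding cl_abs_hull_def by (rule closure_minimal) (rule closed_span)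
qed

section \<open>Packing\<close>

text \<open>Volume comparison: the copies of \<open>(\<delta> / 2) D\<close> centred at the points
  of \<open>P\<close> are disjoint and fit into \<open>(1 + \<delta> / 2) D\<close>.\<close>

lemma abs_convex_packing_bound:
  fixes D :: "'a::euclidean_space set"
  assumes D: "abs_convex D" "compact D" "interior D \<noteq> {}"
    and P: "finite P" "P \<subseteq> D" and \<delta>: "\<delta> > 0"
    and sep: "\<And>p q. p \<in> P \<Longrightarrow> q \<in> P \<Longrightarrow> p \<noteq> q \<Longrightarrow> p - q \<notin> (*\<^sub>R) \<delta> ` D"
  shows "real (card P) \<le> (1 + 2 / \<delta>) ^ DIM('a)"
proof -
  define m where "m = measure lebesgue D"
  have meas: "D \<in> lmeasurable" using D(2) by (rule lmeasurable_compact)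
  \<comment> \<open>A convex set with nonempty interior has positive volume, so the volume can be
    cancelled at the end.\<close>
  have "\<not> negligible D" using D negligible_convex_interior by (auto simp: abs_convex_def)
  then have m: "m > 0"
    using negligible_iff_measure0[OF meas] by (simp add: m_def less_le)
  define B where "B p = (\<lambda>x. (\<delta> / 2) *\<^sub>R x + p) ` D" for p
  have comp: "compact ((\<lambda>x. c *\<^sub>R x + p) ` D)" for c p
    by (intro compact_continuous_image D(2) continuous_intros)
  have mB: "measure lebesgue (B p) = (\<delta> / 2) ^ DIM('a) * m" for p
    using measure_lebesgue_affine[of "\<delta> / 2" p D] \<delta> by (simp add: B_def m_def)
  have "pairwise (\<lambda>i j. disjnt (B i) (B j)) P"
  proof (rule pairwiseI)
    fix p q assume pq: "p \<in> P" "q \<in> P" "p \<noteq> q"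
    show "disjnt (B p) (B q)"
    proof (rule ccontr)
      assume "\<not> disjnt (B p) (B q)"
      then obtain x y where xy: "x \<in> D" "y \<in> D" "(\<delta> / 2) *\<^sub>R x + p = (\<delta> / 2) *\<^sub>R y + q"
        by (auto simp: disjnt_iff B_def)
      \<comment> \<open>A common point of two copies puts \<open>p - q\<close> into the
        \<delta>-dilate of \<open>D\<close>, against the separation.\<close>
      then have "p - q = (\<delta> / 2) *\<^sub>R y + (- (\<delta> / 2)) *\<^sub>R x" by (simp add: algebra_simps)
      also have "\<dots> \<in> (*\<^sub>R) \<delta> ` D" using xy \<delta> by (intro abs_convex_combination D) auto
      finally show False using sep[OF pq] by blast
    qed
  qed
  then have "measure lebesgue (\<Union>p\<in>P. B p) = (\<Sum>p\<in>P. measure lebesgue (B p))"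
    using P(1) comp by (intro measure_UNION') (auto simp: B_def intro: lmeasurable_compact)
  then have eq: "measure lebesgue (\<Union>p\<in>P. B p) = card P * ((\<delta> / 2) ^ DIM('a) * m)"
    by (simp add: mB)
  have "(\<Union>p\<in>P. B p) \<subseteq> (\<lambda>x. (1 + \<delta> / 2) *\<^sub>R x + 0) ` D"
  proof
    fix z assume "z \<in> (\<Union>p\<in>P. B p)"
    then obtain p x where z: "p \<in> D" "x \<in> D" "z = (\<delta> / 2) *\<^sub>R x + 1 *\<^sub>R p"
      using P(2) by (auto simp: B_def)
    have "(\<delta> / 2) *\<^sub>R x + 1 *\<^sub>R p \<in> (*\<^sub>R) (1 + \<delta> / 2) ` D"
      using z \<delta> by (intro abs_convex_combination D) auto
    then show "z \<in> (\<lambda>x. (1 + \<delta> / 2) *\<^sub>R x + 0) ` D" using z by simp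
  qed
  then have "measure lebesgue (\<Union>p\<in>P. B p) \<le> measure lebesgue ((\<lambda>x. (1 + \<delta> / 2) *\<^sub>R x + 0) ` D)"
    using P(1) comp
    by (intro measure_mono_fmeasurable fmeasurableD fmeasurable.finite_UN lmeasurable_compact)
      (auto simp: B_def intro!: compact_scaling D(2))
  also have "\<dots> = (1 + \<delta> / 2) ^ DIM('a) * m"
    using measure_lebesgue_affine[of "1 + \<delta> / 2" 0 D] \<delta> by (simp add: m_def)
  finally have "(card P * (\<delta> / 2) ^ DIM('a)) * m \<le> (1 + \<delta> / 2) ^ DIM('a) * m"
    by (simp add: eq mult.assoc)
  then have "card P * (\<delta> / 2) ^ DIM('a) \<le> (1 + \<delta> / 2) ^ DIM('a)" using m by simp
  then have "card P \<le> (1 + \<delta> / 2) ^ DIM('a) / (\<delta> / 2) ^ DIM('a)"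
    using \<delta> by (simp add: pos_le_divide_eq)
  also have "\<dots> = ((1 + \<delta> / 2) / (\<delta> / 2)) ^ DIM('a)" by (rule power_divide[symmetric])
  also have "(1 + \<delta> / 2) / (\<delta> / 2) = 1 + 2 / \<delta>" using \<delta> by (simp add: field_simps)
  finally show ?thesis .
qed

text \<open>Reduces to a body with nonempty interior. Differences of points of \<open>P\<close> lie
  in \<open>span S\<close>, where the dilates of the thickened body agree with those of the hull, so
  the separation survives.\<close>

lemma cl_abs_hull_packing_bound:
  fixes S :: "'a::euclidean_space set"
  assumes S: "bounded S" and P: "finite P" "P \<subseteq> cl_abs_hull S" and \<delta>: "\<delta> > 0"
    and sep: "\<And>p q. p \<in> P \<Longrightarrow> q \<in> P \<Longrightarrow> p \<noteq> q \<Longrightarrow> p - q \<notin> (*\<^sub>R) \<delta> ` cl_abs_hull S"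
  shows "real (card P) \<le> (1 + 2 / \<delta>) ^ DIM('a)"
proof -
  let ?K = "cl_abs_hull S"
  \<comment> \<open>\<open>S\<close> need not span the space, so its hull is thickened orthogonally to get positive volume.\<close>
  define E where "E = {z. norm z \<le> 1 \<and> (\<forall>y\<in>span S. orthogonal z y)}"
  define D where "D = (\<Union>x\<in>?K. \<Union>y\<in>E. {x + y})"
  have K: "abs_convex ?K" by (rule abs_convex_cl_abs_hull)
  have E_eq: "E = cball 0 1 \<inter> (\<Inter>y\<in>span S. {z. z \<bullet> y = 0})"
    by (auto simp: E_def orthogonal_def)
  have "closed {z. z \<bullet> y = 0}" for y :: 'a
    by (intro closed_Collect_eq continuous_intros)
  then have cE: "compact E" unfolding E_eq by (intro compact_Int_closed) auto
  have "subspace {z. z \<bullet> y = 0}" for y :: 'a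
    by (auto simp: subspace_def inner_add_left)
  then have vE: "convex E" unfolding E_eq
    by (intro convex_Int convex_INT convex_cball) (auto intro: subspace_imp_convex)
  have E0: "0 \<in> E" by (simp add: E_def orthogonal_def)
  have K0: "0 \<in> ?K" using K by (simp add: abs_convex_def)
  have KD: "?K \<subseteq> D" unfolding D_def using E0 by force
  have ED: "E \<subseteq> D" unfolding D_def using K0 by force
  have D: "abs_convex D" unfolding abs_convex_def
  proof (intro conjI ballI)
    show "convex D" unfolding D_def using K vE by (intro convex_sums) (auto simp: abs_convex_def)
    show "0 \<in> D" using KD K0 by blast
    fix z assume "z \<in> D"
    then obtain x y where xy: "z = x + y" "x \<in> ?K" "y \<in> E" by (auto simp: D_def)
    then have "- x \<in> ?K" "- y \<in> E" using K by (auto simp: abs_convex_def E_def orthogonal_def)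
    then show "- z \<in> D" using xy by (force simp: D_def)
  qed
  have cD: "compact D" unfolding D_def by (intro compact_sums' compact_cl_abs_hull S cE)
  \<comment> \<open>Each vector splits into a part in \<open>span S\<close> and an orthogonal part,
    and the latter is a multiple of a vector of \<open>E\<close>.\<close>
  have "z \<in> span D" for z
  proof -
    obtain a b where ab: "a \<in> span S" "\<And>w. w \<in> span S \<Longrightarrow> orthogonal b w" "z = a + b"
      using orthogonal_subspace_decomp_exists by metis
    have "a \<in> span D" using ab(1) span_mono[of S D] KD subset_cl_abs_hull[of S] by blast
    moreover have "b \<in> span D"
    proof (cases "b = 0")
      case False
      have "(1 / norm b) *\<^sub>R b \<in> E" using ab(2) False by (simp add: E_def orthogonal_def)
      then have "(1 / norm b) *\<^sub>R b \<in> span D" using ED span_base by blast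
      then have "norm b *\<^sub>R ((1 / norm b) *\<^sub>R b) \<in> span D" by (rule span_mul)
      then show ?thesis using False by simp
    qed (simp add: span_zero)
    ultimately show ?thesis using ab(3) by (simp add: span_add)
  qed
  then have "span D = UNIV" by blast
  \<comment> \<open>As 0 lies in \<open>D\<close>, the affine hull is the whole space, so the
    relative interior, nonempty by convexity, is the interior.\<close>
  moreover have "affine hull D = span D"
    using KD K0 by (intro affine_hull_span_0 hull_inc) blast
  ultimately have "rel_interior D = interior D" by (intro rel_interior_interior) simp
  moreover have "rel_interior D \<noteq> {}"
    using rel_interior_eq_empty[of D] D KD K0 by (auto simp: abs_convex_def)
  ultimately have int: "interior D \<noteq> {}" by simp
  show ?thesis
  proof (rule abs_convex_packing_bound[OF D cD int P(1) _ \<delta>])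
    show "P \<subseteq> D" using P(2) KD by blast
    fix p q assume pq: "p \<in> P" "q \<in> P" "p \<noteq> q"
    show "p - q \<notin> (*\<^sub>R) \<delta> ` D"
    proof
      assume "p - q \<in> (*\<^sub>R) \<delta> ` D"
      then obtain x y where xy: "x \<in> ?K" "y \<in> E" "p - q = \<delta> *\<^sub>R (x + y)" by (auto simp: D_def)
      have "p - q \<in> span S" "x \<in> span S"
        using pq P(2) xy(1) cl_abs_hull_subset_span[of S] by (auto intro: span_diff)
      \<comment> \<open>The thickening component lies in \<open>span S\<close> and is orthogonal to
        it, hence vanishes.\<close>
      moreover have "y = (1 / \<delta>) *\<^sub>R (p - q) - x" using xy(3) \<delta> by simp
      ultimately have "y \<in> span S" by (simp add: span_diff span_mul)
      then have "y = 0" using xy(2) by (auto simp: E_def orthogonal_self)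
      then show False using sep[OF pq] xy by auto
    qed
  qed
qed

section \<open>Counting unstable states\<close>

text \<open>A representation of \<open>z\<close> in the dilated hull becomes a feasible coefficient
  vector of 1-norm at most \<open>r\<close>, which the minimizer cannot exceed.\<close>

lemma l1_minimizer_sum_le:
  fixes C :: "nat + 'm::finite \<Rightarrow> real^'n"
  assumes l: "l1_minimizer C t z l" and r: "0 \<le> r" and z: "z \<in> (*\<^sub>R) r ` cl_abs_hull (C ` data_idx t)"
  shows "(\<Sum>i\<in>data_idx t. \<bar>l i\<bar>) \<le> r"
proof -
  let ?I = "data_idx t :: (nat + 'm) set"
  have fin: "finite ?I" by (simp add: data_idx_def)
  then have "cl_abs_hull (C ` ?I) = abs_convex_hull (C ` ?I)" by (intro cl_abs_hull_finite) simp
  then obtain N k v where z: "z = r *\<^sub>R (\<Sum>i<N. k i *\<^sub>R v i)" and v: "\<forall>i<(N::nat). v i \<in> C ` ?I"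
      and k: "(\<Sum>i<N. \<bar>k i\<bar>) \<le> 1"
    using z by (auto simp: abs_convex_hull_def)
  have "\<forall>i\<in>{..<N}. \<exists>j. j \<in> ?I \<and> v i = C j" using v by blast
  then obtain f where f: "\<forall>i\<in>{..<N}. f i \<in> ?I \<and> v i = C (f i)"
    using bchoice[of "{..<N}" "\<lambda>i j. j \<in> ?I \<and> v i = C j"] by blast
  \<comment> \<open>The representation may use a column several times; its coefficients are
    collected per column index.\<close>
  define l' where "l' j = r * (\<Sum>i\<in>{i\<in>{..<N}. f i = j}. k i)" for j
  have "data_mult C t l' = r *\<^sub>R (\<Sum>j\<in>?I. \<Sum>i\<in>{i\<in>{..<N}. f i = j}. k i *\<^sub>R v i)"
    unfolding data_mult_def l'_def using f
    by (auto simp: scaleR_sum_left scaleR_sum_right sum_distrib_left intro!: sum.cong)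
  also have "\<dots> = z" unfolding z using f fin by (subst sum.group) auto
  finally have "data_mult C t l' = z" .
  then have "(\<Sum>i\<in>?I. \<bar>l i\<bar>) \<le> (\<Sum>i\<in>?I. \<bar>l' i\<bar>)"
    using l by (auto simp: l1_minimizer_def is_arg_min_linorder)
  also have "\<dots> \<le> (\<Sum>j\<in>?I. r * (\<Sum>i\<in>{i\<in>{..<N}. f i = j}. \<bar>k i\<bar>))"
    unfolding l'_def using r by (intro sum_mono) (auto simp: abs_mult intro!: mult_left_mono)
  also have "\<dots> = r * (\<Sum>i<N. \<bar>k i\<bar>)"
    unfolding sum_distrib_left[symmetric] using f fin by (subst sum.group) auto
  also have "\<dots> \<le> r" using mult_left_mono[OF k r] by simp
  finally show ?thesis .
qed

section \<open>Scalar inequalities in \<mu> and \<kappa>\<close>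

text \<open>For positive \<kappa> the left end point is the positive root of
  \<open>\<mu>\<^sup>2 = \<kappa> * (1 - \<mu>)\<close>. Beyond it, both the denominator in the
  bound and the later separation distance are positive.\<close>

lemma mu_interval_imp:
  assumes \<mu>: "\<mu> \<in> mu_interval \<kappa>" and \<kappa>: "0 \<le> \<kappa>"
  shows "0 < \<mu>" "\<mu> < 1" "\<kappa> * (1 - \<mu>) < \<mu>\<^sup>2"
proof -
  have "0 < \<mu> \<and> \<mu> < 1 \<and> \<kappa> * (1 - \<mu>) < \<mu>\<^sup>2"
  proof (cases "\<kappa> = 0")
    case True
    then show ?thesis using \<mu> by (simp add: mu_interval_def)
  next
    case False
    then have \<kappa>: "\<kappa> > 0" using assms by simp
    define q where "q = sqrt (1/4 + 1/\<kappa>)"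
    have q: "q > 0" unfolding q_def using \<kappa> by (intro real_sqrt_gt_zero add_pos_pos) auto
    have lo: "inverse (q + 1/2) < \<mu>" and hi: "\<mu> < 1" using \<mu> False by (auto simp: mu_interval_def q_def)
    have pos: "0 < \<mu>" using q by (intro less_trans[OF _ lo]) (simp add: add_pos_pos)
    have "inverse \<mu> < q + 1/2" using lo pos q by (simp add: field_simps)
    moreover have "1 < inverse \<mu>" using pos hi by (simp add: one_less_inverse)
    \<comment> \<open>The square is completed in \<open>inverse \<mu>\<close>; as this exceeds 1,
      the left base is nonnegative and squaring is monotone.\<close>
    ultimately have "(inverse \<mu> - 1/2)\<^sup>2 < q\<^sup>2" by (intro power_strict_mono) auto
    also have "\<dots> = 1/4 + 1/\<kappa>" using \<kappa> by (simp add: q_def)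
    finally have "(inverse \<mu>)\<^sup>2 - inverse \<mu> < 1/\<kappa>" by (simp add: power2_diff power_one_over)
    then have "((inverse \<mu>)\<^sup>2 - inverse \<mu>) * (\<kappa> * \<mu>\<^sup>2) < 1/\<kappa> * (\<kappa> * \<mu>\<^sup>2)"
      using \<kappa> pos by (intro mult_strict_right_mono) auto
    moreover have "((inverse \<mu>)\<^sup>2 - inverse \<mu>) * (\<kappa> * \<mu>\<^sup>2) = \<kappa> * (1 - \<mu>)"
      using pos by (simp add: field_simps power2_eq_square)
    moreover have "1/\<kappa> * (\<kappa> * \<mu>\<^sup>2) = \<mu>\<^sup>2" using \<kappa> by simp
    ultimately show ?thesis using pos hi by simp
  qed
  then show "0 < \<mu>" "\<mu> < 1" "\<kappa> * (1 - \<mu>) < \<mu>\<^sup>2" by auto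
qed

lemma unstable_bound_eq_power:
  "unstable_bound n \<mu> \<kappa> =
     1/2 * (\<mu> / (\<mu> - sqrt (\<kappa> * (1 - \<mu>))) * max 1 (\<mu> / (1 - \<mu>))) ^ n"
  unfolding unstable_bound_def power_mult_distrib by (rule mult.assoc)

text \<open>Compares the packing base with the base of the claimed bound. Written with
  \<open>s\<close>, both sides get the denominator \<open>Q\<close>, which leaves a polynomial
  inequality; the cases split at 1/2, where the two arguments of \<open>max\<close>
  coincide.\<close>

lemma packing_ratio_le:
  fixes \<mu> \<kappa> :: real
  defines "s \<equiv> sqrt (\<kappa> * (1 - \<mu>))"
  assumes \<mu>: "0 < \<mu>" "\<mu> < 1" and \<kappa>: "0 < \<kappa>" "\<kappa> * (1 - \<mu>) < \<mu>\<^sup>2"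
  shows "1 + 2 / (\<mu> / \<kappa> - (1 - \<mu>) / \<mu>) \<le> \<mu> / (\<mu> - s) * max 1 (\<mu> / (1 - \<mu>))"
proof -
  have s2: "s\<^sup>2 = \<kappa> * (1 - \<mu>)" using \<mu> \<kappa> by (simp add: s_def)
  have s: "0 < s" "s < \<mu>" using \<mu> \<kappa> real_sqrt_less_mono[OF \<kappa>(2)] by (auto simp: s_def)
  define Q where "Q = (1 - \<mu>) * ((\<mu> - s) * (\<mu> + s))"
  have Q: "Q > 0" using \<mu> s by (simp add: Q_def)
  have "Q = (1 - \<mu>) * (\<mu>\<^sup>2 - s\<^sup>2)"
    by (simp add: Q_def power2_eq_square algebra_simps)
  then have "Q = (1 - \<mu>) * (\<mu>\<^sup>2 - \<kappa> * (1 - \<mu>))" by (simp add: s2)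
  moreover have "\<mu> / \<kappa> - (1 - \<mu>) / \<mu> = (\<mu>\<^sup>2 - \<kappa> * (1 - \<mu>)) / (\<mu> * \<kappa>)"
    using \<mu> \<kappa> by (simp add: field_simps power2_eq_square)
  ultimately have "\<mu> / \<kappa> - (1 - \<mu>) / \<mu> = Q / (\<mu> * s\<^sup>2)" using \<mu> \<kappa> by (simp add: s2)
  then have "1 + 2 / (\<mu> / \<kappa> - (1 - \<mu>) / \<mu>) = (Q + 2 * \<mu> * s\<^sup>2) / Q"
    using Q by (simp add: field_simps)
  also have "\<dots> \<le> \<mu> / (\<mu> - s) * max 1 (\<mu> / (1 - \<mu>))"
  proof (cases "1/2 \<le> \<mu>")
    case True
    \<comment> \<open>The inequality is sharp at \<open>s = \<mu>\<close>; this is the factorization of the difference.\<close>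
    have "0 \<le> (\<mu> - s) * ((3 * \<mu> - 1) * s + \<mu> * (2 * \<mu> - 1))"
      using True s by (intro mult_nonneg_nonneg add_nonneg_nonneg) auto
    also have "\<dots> = \<mu>\<^sup>2 * (\<mu> + s) - (Q + 2 * \<mu> * s\<^sup>2)"
      by (simp add: Q_def algebra_simps power2_eq_square)
    finally have "(Q + 2 * \<mu> * s\<^sup>2) / Q \<le> (\<mu>\<^sup>2 * (\<mu> + s)) / Q"
      using Q by (intro divide_right_mono) auto
    also have "\<dots> = \<mu> / (\<mu> - s) * (\<mu> / (1 - \<mu>))"
      using \<mu> s by (simp add: Q_def power2_eq_square)
    also have "\<dots> \<le> \<mu> / (\<mu> - s) * max 1 (\<mu> / (1 - \<mu>))"
      using \<mu> s by (intro mult_left_mono) auto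
    finally show ?thesis .
  next
    case False
    \<comment> \<open>Below 1/2 the maximum is 1 and \<open>3 * \<mu> - 1 \<le> 1 - \<mu>\<close>;
      with \<open>s < \<mu>\<close> the factored difference is nonnegative.\<close>
    have "(3 * \<mu> - 1) * s \<le> (1 - \<mu>) * s" using False s by (intro mult_right_mono) auto
    also have "\<dots> \<le> (1 - \<mu>) * \<mu>" using \<mu> s by (intro mult_left_mono) auto
    finally have "0 \<le> s * ((1 - \<mu>) * \<mu> - (3 * \<mu> - 1) * s)" using s by simp
    also have "\<dots> = \<mu> * (1 - \<mu>) * (\<mu> + s) - (Q + 2 * \<mu> * s\<^sup>2)"
      by (simp add: Q_def algebra_simps power2_eq_square)
    finally have "(Q + 2 * \<mu> * s\<^sup>2) / Q \<le> (\<mu> * (1 - \<mu>) * (\<mu> + s)) / Q"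
      using Q by (intro divide_right_mono) auto
    also have "\<dots> = \<mu> / (\<mu> - s) * 1" using \<mu> s by (simp add: Q_def)
    also have "\<dots> \<le> \<mu> / (\<mu> - s) * max 1 (\<mu> / (1 - \<mu>))"
      using \<mu> s by (intro mult_left_mono) auto
    finally show ?thesis .
  qed
  finally show ?thesis .
qed

lemma unstable_bound_nonneg:
  assumes "0 < \<mu>" "\<mu> < 1" "0 \<le> \<kappa>" "\<kappa> * (1 - \<mu>) < \<mu>\<^sup>2"
  shows "0 \<le> unstable_bound n \<mu> \<kappa>"
  using assms real_sqrt_less_mono[OF assms(4)] unfolding unstable_bound_def
  by (intro mult_nonneg_nonneg zero_le_power) auto

section \<open>From escaping states to a packing\<close>

text \<open>Separates the geometry from the dynamics: \<open>H\<close> stands for the data hulls,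
  \<open>time\<close> for a chosen visit and \<nu> for the disturbance norm. Packing both signs of
  the normalized states doubles the count, whence the factor 1/2.\<close>

lemma card_escaping_le_unstable_bound:
  fixes S :: "'a::euclidean_space set" and time :: "'a \<Rightarrow> nat" and \<nu> :: "'a \<Rightarrow> real"
  assumes S: "bounded S"
    and \<mu>: "0 < \<mu>" "\<mu> < 1" and \<kappa>: "0 \<le> \<kappa>" "\<kappa> * (1 - \<mu>) < \<mu>\<^sup>2"
    and F: "finite F" "inj_on time F"
    and H: "\<And>t. abs_convex (H t)"
    and \<nu>: "\<And>z. z \<in> F \<Longrightarrow> 0 \<le> \<nu> z" "\<And>z. z \<in> F \<Longrightarrow> z \<in> (*\<^sub>R) (\<nu> z) ` cl_abs_hull S"
    and sub: "\<And>z. z \<in> F \<Longrightarrow> cl_abs_hull S \<subseteq> (*\<^sub>R) \<kappa> ` H (time z)"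
    and past: "\<And>z z'. z \<in> F \<Longrightarrow> z' \<in> F \<Longrightarrow> time z' < time z \<Longrightarrow> z' \<in> H (time z)"
    and escape: "\<And>z. z \<in> F \<Longrightarrow> z \<notin> (*\<^sub>R) (max (\<mu> / (1 - \<mu>)) (\<mu> * \<nu> z)) ` H (time z)"
  shows "real (card F) \<le> unstable_bound DIM('a) \<mu> \<kappa>"
proof (cases "F = {}")
  case True
  then show ?thesis using unstable_bound_nonneg[OF \<mu> \<kappa>] by simp
next
  case False
  let ?K = "cl_abs_hull S"
  have K: "abs_convex ?K" by (rule abs_convex_cl_abs_hull)
  \<comment> \<open>Otherwise \<open>z\<close>, which lies in the \<open>\<kappa> * \<nu> z\<close>
    dilate of \<open>H (time z)\<close>, would lie in the dilate that it escapes.\<close>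
  have large: "max (\<mu> / (1 - \<mu>)) (\<mu> * \<nu> z) < \<kappa> * \<nu> z" if z: "z \<in> F" for z
  proof (rule ccontr)
    assume neg: "\<not> ?thesis"
    obtain k where k: "k \<in> ?K" "z = \<nu> z *\<^sub>R k" using \<nu>(2)[OF z] by blast
    obtain h where h: "h \<in> H (time z)" "k = \<kappa> *\<^sub>R h" using sub[OF z] k by blast
    have mem: "z \<in> (*\<^sub>R) (\<kappa> * \<nu> z) ` H (time z)"
      using h k(2) by (intro image_eqI[of _ _ h]) (auto simp: mult.commute)
    have "0 \<le> \<kappa> * \<nu> z" using \<nu>(1)[OF z] \<kappa>(1) by simp
    from abs_convex_scaled_mono[OF H this neg[unfolded not_less] mem] escape[OF z] show False
      by contradiction
  qed
  have q: "0 < \<mu> / (1 - \<mu>)" using \<mu> by simp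
  have \<nu>\<kappa>: "\<mu> / (1 - \<mu>) < \<kappa> * \<nu> z" if "z \<in> F" for z using large[OF that] by simp
  obtain z0 where z0: "z0 \<in> F" using False by blast
  have \<kappa>0: "0 < \<kappa>" using \<nu>\<kappa>[OF z0] q \<kappa>(1) by (cases "\<kappa> = 0") auto
  have \<nu>0: "0 < \<nu> z" if "z \<in> F" for z
    using \<nu>\<kappa>[OF that] \<nu>(1)[OF that] q by (cases "\<nu> z = 0") auto
  \<comment> \<open>Chosen such that \<open>\<delta> * \<kappa> + \<kappa> * ((1 - \<mu>) / \<mu>) =
    \<mu>\<close>, where the second summand bounds \<open>1 / \<nu> z\<close> for every
    \<open>z\<close> in \<open>F\<close>.\<close>
  define \<delta> where "\<delta> = \<mu> / \<kappa> - (1 - \<mu>) / \<mu>"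
  have \<delta>: "0 < \<delta>" using \<mu> \<kappa> \<kappa>0 by (simp add: \<delta>_def field_simps power2_eq_square)
  have \<delta>\<kappa>: "\<delta> * \<kappa> = \<mu> - \<kappa> * ((1 - \<mu>) / \<mu>)" using \<kappa>0 by (simp add: \<delta>_def algebra_simps)
  define y where "y z = (1 / \<nu> z) *\<^sub>R z" for z
  have yK: "y z \<in> ?K" if z: "z \<in> F" for z
  proof -
    obtain k where k: "k \<in> ?K" and eq: "z = \<nu> z *\<^sub>R k" using \<nu>(2)[OF z] by blast
    have "y z = (1 / \<nu> z) *\<^sub>R (\<nu> z *\<^sub>R k)" unfolding y_def using eq by (rule arg_cong)
    then show ?thesis using k \<nu>0[OF z] by simp
  qed
  have yz: "\<nu> z *\<^sub>R y z = z" if "z \<in> F" for z using \<nu>0[OF that] by (simp add: y_def)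
  \<comment> \<open>The sign \<sigma> treats differences and sums at once. If the points were close,
    the later state would be \<open>\<nu> z\<close> times a combination of \<open>z'\<close> and
    \<open>h\<close>, both in \<open>H (time z)\<close>, of total weight at most \<mu>, and could
    not escape.\<close>
  have sep_aux: "y z - \<sigma> *\<^sub>R y z' \<notin> (*\<^sub>R) \<delta> ` ?K"
    if z: "z \<in> F" "z' \<in> F" "time z' < time z" and \<sigma>: "\<bar>\<sigma>\<bar> = 1" for z z' \<sigma>
  proof
    assume "y z - \<sigma> *\<^sub>R y z' \<in> (*\<^sub>R) \<delta> ` ?K"
    then obtain k where k: "k \<in> ?K" "y z - \<sigma> *\<^sub>R y z' = \<delta> *\<^sub>R k" by blast
    obtain h where h: "h \<in> H (time z)" "k = \<kappa> *\<^sub>R h" using sub[OF z(1)] k by blast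
    have "y z = (\<sigma> / \<nu> z') *\<^sub>R z' + (\<delta> * \<kappa>) *\<^sub>R h"
      using k(2) h(2) by (simp add: y_def[of z'] algebra_simps)
    then have eq: "z = (\<nu> z * (\<sigma> / \<nu> z')) *\<^sub>R z' + (\<nu> z * (\<delta> * \<kappa>)) *\<^sub>R h"
      using yz[OF z(1)] by (metis scaleR_add_right scaleR_scaleR)
    have "1 / \<nu> z' \<le> \<kappa> * ((1 - \<mu>) / \<mu>)"
      using \<nu>\<kappa>[OF z(2)] \<nu>0[OF z(2)] \<mu> by (simp add: field_simps)
    then have "1 / \<nu> z' + \<delta> * \<kappa> \<le> \<mu>" using \<delta>\<kappa> by simp
    then have "\<nu> z * (1 / \<nu> z' + \<delta> * \<kappa>) \<le> \<nu> z * \<mu>"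
      using \<nu>0[OF z(1)] by (intro mult_left_mono) auto
    moreover have "\<bar>\<nu> z * (\<sigma> / \<nu> z')\<bar> + \<bar>\<nu> z * (\<delta> * \<kappa>)\<bar> = \<nu> z * (1 / \<nu> z' + \<delta> * \<kappa>)"
      using \<nu>0[OF z(1)] \<nu>0[OF z(2)] \<delta> \<kappa>0 \<sigma> by (simp add: abs_mult distrib_left)
    ultimately have "\<bar>\<nu> z * (\<sigma> / \<nu> z')\<bar> + \<bar>\<nu> z * (\<delta> * \<kappa>)\<bar> \<le> max (\<mu> / (1 - \<mu>)) (\<mu> * \<nu> z)"
      by (simp add: mult.commute)
    from abs_convex_combination[OF H past[OF z] h(1) this] escape[OF z(1)] eq show False by simp
  qed
  have sep: "y z - \<sigma> *\<^sub>R y z' \<notin> (*\<^sub>R) \<delta> ` ?K"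
    if z: "z \<in> F" "z' \<in> F" "z \<noteq> z'" and \<sigma>: "\<bar>\<sigma>\<bar> = 1" for z z' \<sigma>
  proof (cases "time z' < time z")
    case True
    then show ?thesis using sep_aux z \<sigma> by blast
  next
    case False
    with F(2) z have lt: "time z < time z'" by (metis inj_onD linorder_neqE_nat)
    show ?thesis
    proof
      assume "y z - \<sigma> *\<^sub>R y z' \<in> (*\<^sub>R) \<delta> ` ?K"
      then obtain k where k: "k \<in> ?K" "y z - \<sigma> *\<^sub>R y z' = \<delta> *\<^sub>R k" by blast
      have "\<sigma> * \<sigma> = 1" using \<sigma> by (metis abs_mult_self_eq mult_1)
      then have "y z' - \<sigma> *\<^sub>R y z = - (\<sigma> *\<^sub>R (y z - \<sigma> *\<^sub>R y z'))" by (simp add: algebra_simps)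
      also have "\<dots> = \<delta> *\<^sub>R (- (\<sigma> *\<^sub>R k))" by (simp add: k(2))
      finally have "y z' - \<sigma> *\<^sub>R y z = \<delta> *\<^sub>R (- (\<sigma> *\<^sub>R k))" .
      moreover have "- (\<sigma> *\<^sub>R k) \<in> ?K"
        using \<sigma> k(1) K by (cases "\<sigma> = 1") (auto simp: abs_convex_def abs_if split: if_splits)
      ultimately show False using sep_aux[OF z(2,1) lt \<sigma>] by blast
    qed
  qed
  \<comment> \<open>The pair \<open>y z\<close>, \<open>- y z\<close> is treated separately, as
    \<open>past\<close> says nothing about \<open>z\<close> itself. Here
    \<open>\<delta> * \<kappa> \<le> \<mu>\<close> suffices.\<close>
  have self: "2 *\<^sub>R y z \<notin> (*\<^sub>R) \<delta> ` ?K" if z: "z \<in> F" for z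
  proof
    assume "2 *\<^sub>R y z \<in> (*\<^sub>R) \<delta> ` ?K"
    then obtain k where k: "k \<in> ?K" "2 *\<^sub>R y z = \<delta> *\<^sub>R k" by blast
    obtain h where h: "h \<in> H (time z)" "k = \<kappa> *\<^sub>R h" using sub[OF z] k by blast
    have "z = (\<nu> z / 2) *\<^sub>R (2 *\<^sub>R y z)" using yz[OF z] by simp
    also have "\<dots> = (\<nu> z / 2 * (\<delta> * \<kappa>)) *\<^sub>R h" unfolding k(2) h(2) by simp
    finally have "z \<in> (*\<^sub>R) (\<nu> z / 2 * (\<delta> * \<kappa>)) ` H (time z)" using h(1) by blast
    moreover have "\<nu> z / 2 * (\<delta> * \<kappa>) \<le> \<nu> z * \<mu>"
    proof (rule mult_mono)
      show "\<delta> * \<kappa> \<le> \<mu>" using \<delta>\<kappa> \<kappa>0 \<mu> by simp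
    qed (use \<nu>0[OF z] \<delta> \<kappa>0 in auto)
    then have "\<nu> z / 2 * (\<delta> * \<kappa>) \<le> max (\<mu> / (1 - \<mu>)) (\<mu> * \<nu> z)" by (simp add: mult.commute)
    moreover have "0 \<le> \<nu> z / 2 * (\<delta> * \<kappa>)" using \<nu>0[OF z] \<delta> \<kappa>0 by simp
    ultimately show False using abs_convex_scaled_mono[OF H] escape[OF z] by blast
  qed
  \<comment> \<open>Since 0 lies in the \<delta>-dilate, separated points are distinct; this gives
    injectivity of \<open>y\<close> and disjointness of the two signs.\<close>
  have zero: "0 \<in> (*\<^sub>R) \<delta> ` ?K" using K by (force simp: abs_convex_def)
  define P where "P = y ` F \<union> (\<lambda>z. - y z) ` F"
  have inj: "inj_on y F"
    using sep[where \<sigma> = 1] zero by (intro inj_onI) (metis abs_one diff_self scaleR_one)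
  have "y z \<noteq> - y z'" if "z \<in> F" "z' \<in> F" for z z'
  proof
    assume eq: "y z = - y z'"
    show False
    proof (cases "z = z'")
      case True
      have "y z + y z' = 0" using eq by simp
      then have "2 *\<^sub>R y z = 0" using True by (simp add: scaleR_2)
      then show False using self[OF that(1)] zero by simp
    next
      case False
      then show False using eq sep[OF that, of "-1"] zero by simp
    qed
  qed
  then have "y ` F \<inter> (\<lambda>z. - y z) ` F = {}" by blast
  moreover have "inj_on (\<lambda>z. - y z) F" using inj by (simp add: inj_on_def)
  ultimately have card: "card P = 2 * card F"
    unfolding P_def using F(1) inj by (simp add: card_Un_disjoint card_image)
  have neg: "- k \<in> ?K" if "k \<in> ?K" for k using that K by (simp add: abs_convex_def)
  have neg': "- v \<in> (*\<^sub>R) \<delta> ` ?K" if v: "v \<in> (*\<^sub>R) \<delta> ` ?K" for v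
  proof -
    obtain k where "k \<in> ?K" "v = \<delta> *\<^sub>R k" using v by blast
    then show ?thesis using neg[of k] by (intro image_eqI[of _ _ "- k"]) auto
  qed
  have "real (card P) \<le> (1 + 2 / \<delta>) ^ DIM('a)"
  proof (rule cl_abs_hull_packing_bound[OF S _ _ \<delta>])
    show "finite P" unfolding P_def using F(1) by simp
    show "P \<subseteq> ?K" unfolding P_def using yK neg by blast
    have plus: "y z + y z' \<notin> (*\<^sub>R) \<delta> ` ?K" if "z \<in> F" "z' \<in> F" for z z'
      using sep[OF that, of "-1"] self[OF that(1)] by (cases "z = z'") (auto simp: scaleR_2)
    have minus: "y z - y z' \<notin> (*\<^sub>R) \<delta> ` ?K" if "z \<in> F" "z' \<in> F" "y z \<noteq> y z'" for z z'
      using sep[OF that(1,2), of 1] that(3) by auto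
    fix p q assume pq: "p \<in> P" "q \<in> P" "p \<noteq> q"
    show "p - q \<notin> (*\<^sub>R) \<delta> ` ?K"
    proof
      assume A: "p - q \<in> (*\<^sub>R) \<delta> ` ?K"
      have B: "q - p \<in> (*\<^sub>R) \<delta> ` ?K" using neg'[OF A] by simp
      from pq(1,2) consider
          z z' where "z \<in> F" "z' \<in> F" "p = y z" "q = y z'"
        | z z' where "z \<in> F" "z' \<in> F" "p = y z" "q = - y z'"
        | z z' where "z \<in> F" "z' \<in> F" "p = - y z" "q = y z'"
        | z z' where "z \<in> F" "z' \<in> F" "p = - y z" "q = - y z'"
        unfolding P_def by blast
      then show False
      proof cases
        case 1 then show False using minus A pq(3) by blast
      next
        case (2 z z') then show False using plus[of z z'] A by simp
      next
        case (3 z z') then show False using plus[of z' z] B by simp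
      next
        case (4 z z') then show False using minus[of z z'] B pq(3) by simp
      qed
    qed
  qed
  also have "\<dots> \<le> (\<mu> / (\<mu> - sqrt (\<kappa> * (1 - \<mu>))) * max 1 (\<mu> / (1 - \<mu>))) ^ DIM('a)"
    using packing_ratio_le[OF \<mu> \<kappa>0 \<kappa>(2)] \<delta> unfolding \<delta>_def[symmetric]
    by (intro power_mono) auto
  finally show ?thesis by (simp add: unstable_bound_eq_power card)
qed

section \<open>Data hulls and unstable transitions\<close>

text \<open>The initial columns alone span the space and occur in every data matrix; hence the
  disturbances have finite norm relative to the data.\<close>

lemma span_state_set:
  assumes "rank (X0 :: real^'m::finite^'n) = CARD('n)"
  shows "span (state_set X0 x t) = UNIV"
proof -
  have "columns X0 \<subseteq> state_set X0 x t"
    by (force simp: columns_def state_set_def data_col_def data_idx_def)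
  moreover have "span (columns X0) = UNIV"
    using assms by (simp add: column_rank_def dim_eq_full[symmetric])
  ultimately show ?thesis using span_mono by blast
qed

lemma finite_state_set: "finite (state_set X0 x t)"
  by (simp add: state_set_def data_idx_def)

lemma state_set_mono: "s \<le> t \<Longrightarrow> state_set X0 x s \<subseteq> state_set X0 x t"
  by (auto simp: state_set_def data_idx_def)

lemma state_in_state_set: "s < t \<Longrightarrow> x s \<in> state_set X0 x t"
  by (force simp: state_set_def data_idx_def data_col_def)

text \<open>The supremum is finite and each norm is attained, so the inclusion holds with the factor
  \<kappa> itself, without slack.\<close>

lemma cl_abs_hull_subset_scaled:
  fixes S S' :: "'a::euclidean_space set"
  assumes S: "bounded S" "bounded S'" "S' \<subseteq> span S"
  defines "\<kappa> \<equiv> real_of_ereal (set_norm_set S S')"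
  shows "0 \<le> \<kappa>" "cl_abs_hull S' \<subseteq> (*\<^sub>R) \<kappa> ` cl_abs_hull S"
proof -
  have \<kappa>: "set_norm_set S S' = ereal \<kappa>"
    unfolding \<kappa>_def using set_norm_set_finite[OF S] by (simp add: ereal_real')
  have sub: "cl_abs_hull S' \<subseteq> span S"
    using cl_abs_hull_subset_span[of S'] span_minimal[OF S(3)] by auto
  have *: "\<exists>r. 0 \<le> r \<and> r \<le> \<kappa> \<and> z \<in> (*\<^sub>R) r ` cl_abs_hull S" if z: "z \<in> cl_abs_hull S'" for z
  proof -
    obtain r where r: "set_norm S z = ereal r" "0 \<le> r" "z \<in> (*\<^sub>R) r ` cl_abs_hull S"
      by (rule set_norm_attained[OF S(1) subsetD[OF sub z]])
    have "set_norm S z \<le> set_norm_set S S'" unfolding set_norm_set_def using z by (rule SUP_upper)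
    then show ?thesis using r \<kappa> by auto
  qed
  have "0 \<in> cl_abs_hull S'"
    using abs_convex_cl_abs_hull[of S'] by (simp add: abs_convex_def)
  then show "0 \<le> \<kappa>" using *[of 0] by linarith
  show "cl_abs_hull S' \<subseteq> (*\<^sub>R) \<kappa> ` cl_abs_hull S"
    using * abs_convex_scaled_mono[OF abs_convex_cl_abs_hull] by blast
qed

text \<open>The next state carries the minimizer's coefficients on earlier disturbances and weight 1
  on the current one, which accounts for the summand 1.\<close>

lemma data_mult_plus_in_scaled_hull:
  fixes C :: "nat + 'm::finite \<Rightarrow> real^'n" and l :: "nat + 'm \<Rightarrow> real"
  assumes C: "\<And>i. i \<in> data_idx t \<Longrightarrow> C i \<in> S" and v: "v \<in> S"
  defines "z \<equiv> - data_mult C t l + v"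
  shows "z \<in> span S" "z \<in> (*\<^sub>R) ((\<Sum>i\<in>data_idx t. \<bar>l i\<bar>) + 1) ` cl_abs_hull S"
proof -
  let ?L = "\<Sum>i\<in>data_idx t. \<bar>l i\<bar>"
  show "z \<in> span S"
    unfolding z_def data_mult_def using C v
    by (intro span_add span_neg span_sum span_mul) (auto intro: span_base)
  have "data_mult C t l \<in> (*\<^sub>R) ?L ` cl_abs_hull S"
    unfolding data_mult_def using C subset_cl_abs_hull[of S]
    by (intro abs_convex_sum abs_convex_cl_abs_hull) (auto simp: data_idx_def)
  then obtain k where k: "k \<in> cl_abs_hull S" "data_mult C t l = ?L *\<^sub>R k" by blast
  have "(- ?L) *\<^sub>R k + 1 *\<^sub>R v \<in> (*\<^sub>R) (?L + 1) ` cl_abs_hull S"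
    using k v subset_cl_abs_hull[of S]
    by (intro abs_convex_combination abs_convex_cl_abs_hull) (auto simp: sum_nonneg)
  then show "z \<in> (*\<^sub>R) (?L + 1) ` cl_abs_hull S" using k(2) by (simp add: z_def)
qed

text \<open>The norm of the next state exceeds the threshold but is at most one more than the
  minimal 1-norm; so that 1-norm is large, and \<open>z\<close> cannot lie in a small dilate of the
  data hull.\<close>

lemma unstable_state_escapes:
  assumes W: "bounded W"
    and \<mu>: "0 < \<mu>" "\<mu> < 1"
    and C: "\<And>i. i \<in> data_idx t \<Longrightarrow> C i \<in> W" and v: "v \<in> W"
    and xp: "xp = - data_mult C t l + v"
    and l: "l1_minimizer D t z l"
    and unst: "(xp, z) \<in> unstable W \<mu>"
  defines "\<nu> \<equiv> real_of_ereal (set_norm W z)"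
  shows "0 \<le> \<nu>" "z \<in> (*\<^sub>R) \<nu> ` cl_abs_hull W"
    "z \<notin> (*\<^sub>R) (max (\<mu> / (1 - \<mu>)) (\<mu> * \<nu>)) ` cl_abs_hull (D ` data_idx t)"
proof -
  let ?L = "\<Sum>i\<in>data_idx t. \<bar>l i\<bar>"
  have gt: "max (ereal (1 / (1 - \<mu>))) (ereal \<mu> * set_norm W z + 1) < set_norm W xp"
    using unst by (simp add: unstable_def)
  \<comment> \<open>Outside \<open>span W\<close> the threshold would be infinite and nothing could
    exceed it; so \<open>real_of_ereal\<close> is applied to a finite value.\<close>
  have z: "z \<in> span W"
  proof (rule ccontr)
    assume "z \<notin> span W"
    then have "set_norm W z = \<infinity>" by (simp add: set_norm_def)
    then show False using gt \<mu> by simp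
  qed
  obtain r where r: "set_norm W z = ereal r" "0 \<le> r" "z \<in> (*\<^sub>R) r ` cl_abs_hull W"
    by (rule set_norm_attained[OF W z])
  have \<nu>: "\<nu> = r" by (simp add: \<nu>_def r)
  show "0 \<le> \<nu>" "z \<in> (*\<^sub>R) \<nu> ` cl_abs_hull W" using r \<nu> by auto
  have "set_norm W xp \<le> ereal (?L + 1)"
    unfolding xp using data_mult_plus_in_scaled_hull[where C = C and l = l, OF C v]
    by (intro set_norm_le_imp) (auto simp: sum_nonneg add_nonneg_nonneg)
  with gt have "max (ereal (1 / (1 - \<mu>))) (ereal \<mu> * set_norm W z + 1) < ereal (?L + 1)"
    by (rule less_le_trans)
  then have "1 / (1 - \<mu>) < ?L + 1" "\<mu> * \<nu> < ?L" by (auto simp: r \<nu> one_ereal_def)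
  \<comment> \<open>Subtracting 1 turns the threshold \<open>1 / (1 - \<mu>)\<close> into the radius
    \<open>\<mu> / (1 - \<mu>)\<close>.\<close>
  moreover have "1 / (1 - \<mu>) = \<mu> / (1 - \<mu>) + 1" using \<mu> by (simp add: field_simps)
  ultimately have less: "max (\<mu> / (1 - \<mu>)) (\<mu> * \<nu>) < ?L" by simp
  show "z \<notin> (*\<^sub>R) (max (\<mu> / (1 - \<mu>)) (\<mu> * \<nu>)) ` cl_abs_hull (D ` data_idx t)"
  proof
    assume "z \<in> (*\<^sub>R) (max (\<mu> / (1 - \<mu>)) (\<mu> * \<nu>)) ` cl_abs_hull (D ` data_idx t)"
    from l1_minimizer_sum_le[OF l _ this] less \<mu> show False by (simp add: le_max_iff_disj)
  qed
qed

text \<open>Bounding all finite subsets yields finiteness as well; a bound on \<open>card\<close>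
  alone would not, because \<open>card\<close> is 0 on infinite sets.\<close>

lemma finite_card_le_real:
  assumes "\<And>F. F \<subseteq> S \<Longrightarrow> finite F \<Longrightarrow> real (card F) \<le> c"
  shows "finite S \<and> real (card S) \<le> c"
proof -
  have "finite S \<and> card S \<le> nat \<lfloor>c\<rfloor>"
    using assms by (intro finite_if_finite_subsets_card_bdd) (simp add: le_nat_floor)
  then show ?thesis using assms[of S] by blast
qed

theorem theoremV1:
  fixes A :: "real^'n^'n"
    and X0 U0 Xp0 :: "real^'m^'n"
    and w x u :: "nat \<Rightarrow> real^'n"
    and lam :: "nat \<Rightarrow> real^'n \<Rightarrow> nat + 'm \<Rightarrow> real"
    and \<tau> :: nat and \<kappa> :: real and W :: "(real^'n) set"
  assumes "bounded (range w)"
    and "CARD('m) > CARD('n)"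
    and "rank X0 = CARD('n)"
    and "closed_loop A X0 U0 Xp0 w lam x u"
  defines "W \<equiv> dist_set A X0 U0 Xp0 w"
    and "\<kappa> \<equiv> real_of_ereal (set_norm_set (state_set X0 x \<tau>) W)"
  shows "\<forall>\<mu>\<in>mu_interval \<kappa>.
    finite (unstable_states W \<mu> x \<tau>) \<and>
    real (card (unstable_states W \<mu> x \<tau>)) \<le> unstable_bound CARD('n) \<mu> \<kappa>"
proof (rule ballI, rule finite_card_le_real)
  fix \<mu> F
  assume \<mu>I: "\<mu> \<in> mu_interval \<kappa>" and F: "F \<subseteq> unstable_states W \<mu> x \<tau>" "finite F"
  let ?V = "virtual_dist A X0 U0 Xp0"
  have "columns ?V = range (\<lambda>j. column j ?V)" by (auto simp: columns_def)
  then have "bounded (columns ?V)" by (simp add: finite_imp_bounded)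
  then have W: "bounded W" using assms(1) by (simp add: W_def dist_set_def)
  have \<kappa>: "0 \<le> \<kappa>" "cl_abs_hull W \<subseteq> (*\<^sub>R) \<kappa> ` cl_abs_hull (state_set X0 x \<tau>)"
    unfolding \<kappa>_def
    using cl_abs_hull_subset_scaled[OF finite_imp_bounded[OF finite_state_set] W,
        of X0 x \<tau>] span_state_set[OF assms(3)] by auto
  note \<mu> = mu_interval_imp[OF \<mu>I \<kappa>(1)]
  have step: "x (Suc t) = - data_mult (data_col w ?V) t (lam t (x t)) + w t"
    and min: "l1_minimizer (data_col x X0) t z (lam t z)" for t z
    using assms(4) unfolding closed_loop_iff by blast+
  have col: "data_col w ?V i \<in> W" "w t \<in> W" for i t
    by (auto simp: W_def dist_set_def data_col_def columns_def split: sum.split)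
  \<comment> \<open>One unstable visit is chosen per state, so repeated states count once and
    \<open>time\<close> is injective.\<close>
  have "\<exists>t. z = x t \<and> \<tau> \<le> t \<and> (x (Suc t), x t) \<in> unstable W \<mu>" if "z \<in> F" for z
    using that F(1) by (auto simp: unstable_states_def)
  then obtain time where time: "\<And>z. z \<in> F \<Longrightarrow> x (time z) = z" "\<And>z. z \<in> F \<Longrightarrow> \<tau> \<le> time z"
      "\<And>z. z \<in> F \<Longrightarrow> (x (Suc (time z)), z) \<in> unstable W \<mu>"
    by metis
  note escapes = unstable_state_escapes[OF W \<mu>(1,2) col step min, folded state_set_def]
  have "real (card F) \<le> unstable_bound DIM(real^'n) \<mu> \<kappa>"
  proof (rule card_escaping_le_unstable_bound[OF W \<mu>(1,2) \<kappa>(1) \<mu>(3) F(2), of time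
        "\<lambda>t. cl_abs_hull (state_set X0 x t)" "\<lambda>z. real_of_ereal (set_norm W z)"])
    show "inj_on time F" using time(1) by (metis inj_onI)
    show "abs_convex (cl_abs_hull (state_set X0 x t))" for t by (rule abs_convex_cl_abs_hull)
    show "z' \<in> cl_abs_hull (state_set X0 x (time z))"
      if "z \<in> F" "z' \<in> F" "time z' < time z" for z z'
      using subsetD[OF subset_cl_abs_hull state_in_state_set[OF that(3), of x X0]]
      by (simp add: time(1)[OF that(2)])
    fix z assume z: "z \<in> F"
    \<comment> \<open>Data hulls grow with time, so the factor \<kappa> fixed at \<tau> serves every
      later visit.\<close>
    show "cl_abs_hull W \<subseteq> (*\<^sub>R) \<kappa> ` cl_abs_hull (state_set X0 x (time z))"
      using \<kappa>(2) cl_abs_hull_mono[OF state_set_mono[OF time(2)[OF z]]] by blast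
    have "(x (Suc (time z)), x (time z)) \<in> unstable W \<mu>" using time z by simp
    from escapes[OF this]
    show "0 \<le> real_of_ereal (set_norm W z)"
      "z \<in> (*\<^sub>R) (real_of_ereal (set_norm W z)) ` cl_abs_hull W"
      "z \<notin> (*\<^sub>R) (max (\<mu> / (1 - \<mu>)) (\<mu> * real_of_ereal (set_norm W z))) `
         cl_abs_hull (state_set X0 x (time z))"
      using time(1)[OF z] by auto
  qed
  then show "real (card F) \<le> unstable_bound CARD('n) \<mu> \<kappa>" by simp
qed

end
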